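(* Let $Q$ be the sequence-form polytope of a tree-form sequential decision process with set of decision points $\mathcal J$, action sets $A_j$, and set of sequences $\Sigma$. The dilatable global entropy $\tilde\varphi: Q\to\mathbb R_{\ge0}$, \[ \tilde\varphi(x) = w_\varnothing x_\varnothing\log x_\varnothing + \sum_{j\in\mathcal J}\sum_{a\in A_j} w_{ja}\,x_{ja}\log x_{ja} + \sum_{j\in\mathcal J}\gamma_j\, x_{p_j}\log|A_j|, \] (with the weights $\gamma,w$ defined in the context) is a distance-generating function for $Q$, and it is $1$-strongly convex on $\operatorname{relint}Q$ with respect to the $\ell_2$ norm.
   Context: Tree-form sequential decision process: a finite set $\mathcal J$ of decision points; each $j\in\mathcal J$ has a finite nonempty set of actions $A_j$. The set of sequences is $\Sigma=\{\varnothing\}\cup\{ja: j\in\mathcal J, a\in A_j\}$, where $\varnothing$ is a special element called the empty sequence. For each pair $ja$, $\mathcal C_{ja}\subset\mathcal J$ is the (possibly empty) set of next potential decision points after taking action $a$ at $j$; the decision points form a tree (forest), so $\mathcal C_{ja}\cap\mathcal C_{j'a'}=\emptyset$ whenever $ja\neq j'a'$. The parent sequence $p_j\in\Sigma$ of $j$ is the last sequence encountered on the path from the root to $j$ (so $p_{j'}=ja$ iff $j'\in\mathcal C_{ja}$), and $p_j=\varnothing$ if there is none; $\mathcal C_\varnothing=\{j\in\mathcal J: p_j=\varnothing\}$. The sequence-form polytope $Q$ is the set of all $x\in\mathbb R^{|\Sigma|}_{\ge0}$ with $x_\varnothing=1$ and $\sum_{a\in A_j}x_{ja}=x_{p_j}$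 for all $j\in\mathcal J$. Weights, defined recursively: \[ \gamma_\varnothing = 1+\sum_{j\in\mathcal C_\varnothing}\gamma_j,\qquad \gamma_j = 1+\max_{a\in A_j}\Big\{\sum_{j'\in\mathcal C_{ja}}\gamma_{j'}\Big\}\ (j\in\mathcal J), \] \[ w_\varnothing = \gamma_\varnothing-\sum_{j\in\mathcal C_\varnothing}\gamma_j,\qquad w_{ja} = \gamma_j-\sum_{j'\in\mathcal C_{ja}}\gamma_{j'}\ (j\in\mathcal J,\ a\in A_j). \] Convention: $0\log 0=0$. A distance-generating function (DGF) for a compact convex set $\mathcal X\subseteq\mathbb R^n$ is a function $d:\mathcal X\to\mathbb R$ that is continuous on $\mathcal X$, differentiable in $\operatorname{relint}\mathcal X$, strongly convex in $\operatorname{relint}\mathcal X$ with respect to some norm, and satisfies $\min_{x\in\mathcal X}d(x)=0$. Here $d$ is $\mu$-strongly convex on $\operatorname{relint}\mathcal X$ with respect to $\|\cdot\|$ if $(\nabla d(x)-\nabla d(x'))^\top(x-x')\ge\mu\|x-x'\|^2$ for all $x,x'\in\operatorname{relint}\mathcal X$. *)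

theory Defs
  imports "HOL-Analysis.Analysis"
begin

section \<open>Distance-generating functions\<close>

definition is_norm :: "('v::real_vector \<Rightarrow> real) \<Rightarrow> bool" where
  "is_norm N \<longleftrightarrow>
     (\<forall>x. 0 \<le> N x) \<and> (\<forall>x. N x = 0 \<longleftrightarrow> x = 0) \<and>
     (\<forall>c x. N (c *\<^sub>R x) = \<bar>c\<bar> * N x) \<and> (\<forall>x y. N (x + y) \<le> N x + N y)"

text \<open>
  The function \<open>d\<close> is only meaningful on \<open>X\<close>, so gradients are taken relative to the relative
  interior of \<open>X\<close>. When \<open>X\<close> is not full-dimensional such a gradient is unique only up to vectors
  orthogonal to the affine hull of \<open>X\<close>. Those vectors do not affect the inner product with
  \<open>x - x'\<close> below, so quantifying over all gradients is harmless.
\<close>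

definition relint_gradient ::
    "('v::euclidean_space) set \<Rightarrow> ('v \<Rightarrow> real) \<Rightarrow> 'v \<Rightarrow> 'v \<Rightarrow> bool" where
  "relint_gradient X d x g \<longleftrightarrow>
     (d has_derivative (\<lambda>h. g \<bullet> h)) (at x within rel_interior X)"

definition strongly_convex_on_relint ::
    "real \<Rightarrow> ('v \<Rightarrow> real) \<Rightarrow> ('v::euclidean_space) set \<Rightarrow> ('v \<Rightarrow> real) \<Rightarrow> bool" where
  "strongly_convex_on_relint \<mu> N X d \<longleftrightarrow>
     d differentiable_on rel_interior X \<and>
     (\<forall>x \<in> rel_interior X. \<forall>x' \<in> rel_interior X. \<forall>g g'.
        relint_gradient X d x g \<longrightarrow> relint_gradient X d x' g' \<longrightarrow>
        (g - g') \<bullet> (x - x') \<ge> \<mu> * (N (x - x'))\<^sup>2)"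

definition is_dgf :: "('v::euclidean_space) set \<Rightarrow> ('v \<Rightarrow> real) \<Rightarrow> bool" where
  "is_dgf X d \<longleftrightarrow>
     compact X \<and> convex X \<and>
     continuous_on X d \<and>
     d differentiable_on rel_interior X \<and>
     (\<exists>N \<mu>. is_norm N \<and> \<mu> > 0 \<and> strongly_convex_on_relint \<mu> N X d) \<and>
     (\<exists>x \<in> X. d x = 0) \<and> (\<forall>x \<in> X. 0 \<le> d x)"


section \<open>Tree-form sequential decision processes\<close>

text \<open>
  The empty sequence is encoded as \<open>None\<close> and the sequence \<open>ja\<close> as \<open>Some (j, a)\<close>.
\<close>

locale tfsdp =
  fixes J :: "'j set"
    and A :: "'j \<Rightarrow> 'a set"
    and C :: "'j \<Rightarrow> 'a \<Rightarrow> 'j set"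
  assumes finite_J: "finite J"
    and finite_A: "j \<in> J \<Longrightarrow> finite (A j)"
    and A_nonempty: "j \<in> J \<Longrightarrow> A j \<noteq> {}"
    and C_subset: "j \<in> J \<Longrightarrow> a \<in> A j \<Longrightarrow> C j a \<subseteq> J"
    and C_disjoint:
      "j \<in> J \<Longrightarrow> a \<in> A j \<Longrightarrow> j' \<in> J \<Longrightarrow> a' \<in> A j' \<Longrightarrow> (j, a) \<noteq> (j', a') \<Longrightarrow>
       C j a \<inter> C j' a' = {}"
    and C_acyclic: "acyclic {(j, j'). j \<in> J \<and> (\<exists>a \<in> A j. j' \<in> C j a)}"
begin

definition sequences :: "('j \<times> 'a) option set" where
  "sequences = {None} \<union> {Some (j, a) | j a. j \<in> J \<and> a \<in> A j}"

definition parent :: "'j \<Rightarrow> ('j \<times> 'a) option" where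
  "parent j =
     (if \<exists>j' \<in> J. \<exists>a \<in> A j'. j \<in> C j' a
      then Some (THE (j', a). j' \<in> J \<and> a \<in> A j' \<and> j \<in> C j' a)
      else None)"

lemma parent_eq_Some:
  assumes "j' \<in> J" "a \<in> A j'" "j \<in> C j' a"
  shows "parent j = Some (j', a)"
proof -
  have "(THE (j', a). j' \<in> J \<and> a \<in> A j' \<and> j \<in> C j' a) = (j', a)"
    using assms C_disjoint by (intro the_equality) blast+
  with assms show ?thesis by (auto simp: parent_def)
qed

lemma parent_eq_Some_iff:
  assumes "j' \<in> J" "a \<in> A j'"
  shows "parent j = Some (j', a) \<longleftrightarrow> j \<in> C j' a"
proof
  assume *: "parent j = Some (j', a)"
  then obtain j'' a'' where "j'' \<in> J" "a'' \<in> A j''" "j \<in> C j'' a''"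
    by (auto simp: parent_def split: if_splits)
  with parent_eq_Some[OF this] * show "j \<in> C j' a" by simp
qed (use assms parent_eq_Some in blast)

definition roots :: "'j set" where
  "roots = {j \<in> J. parent j = None}"

lemma wf_child: "wf {(j', j). j \<in> J \<and> (\<exists>a \<in> A j. j' \<in> C j a)}"
proof -
  let ?R = "{(j, j'). j \<in> J \<and> (\<exists>a \<in> A j. j' \<in> C j a)}"
  have "?R \<subseteq> J \<times> J" using C_subset by blast
  then have "finite ?R" using finite_J by (blast intro: finite_subset)
  then have "wf (?R\<inverse>)" using C_acyclic by (rule finite_acyclic_wf_converse)
  moreover have "?R\<inverse> = {(j', j). j \<in> J \<and> (\<exists>a \<in> A j. j' \<in> C j a)}" by auto
  ultimately show ?thesis by simp
qed

text \<open>The value \<open>0\<close> outside \<open>J\<close> only serves to make the recursion total.\<close>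

function gamma :: "'j \<Rightarrow> real" where
  "gamma j =
     (if j \<in> J then 1 + Max ((\<lambda>a. \<Sum>j' \<in> C j a. gamma j') ` A j) else 0)"
  by auto
termination
  by (relation "{(j', j). j \<in> J \<and> (\<exists>a \<in> A j. j' \<in> C j a)}") (use wf_child in auto)

declare gamma.simps [simp del]

definition gamma_root :: real where
  "gamma_root = 1 + (\<Sum>j \<in> roots. gamma j)"

fun w :: "('j \<times> 'a) option \<Rightarrow> real" where
  "w None = gamma_root - (\<Sum>j \<in> roots. gamma j)"
| "w (Some (j, a)) = gamma j - (\<Sum>j' \<in> C j a. gamma j')"

text \<open>
  Below, \<open>idx\<close> is meant to be a bijection from the set of sequences onto the finite type \<open>'s\<close>,
  so that \<open>real ^ 's\<close> is the Euclidean space with one coordinate per sequence. The convention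
  \<open>0 log 0 = 0\<close> holds since the factor \<open>0\<close> annihilates the logarithm.
\<close>

definition sequence_polytope :: "(('j \<times> 'a) option \<Rightarrow> 's::finite) \<Rightarrow> (real ^ 's) set" where
  "sequence_polytope idx =
     {x. (\<forall>\<sigma> \<in> sequences. 0 \<le> x $ idx \<sigma>) \<and>
         x $ idx None = 1 \<and>
         (\<forall>j \<in> J. (\<Sum>a \<in> A j. x $ idx (Some (j, a))) = x $ idx (parent j))}"

definition dilatable_entropy ::
    "(('j \<times> 'a) option \<Rightarrow> 's::finite) \<Rightarrow> real ^ 's \<Rightarrow> real" where
  "dilatable_entropy idx x =
     w None * (x $ idx None) * ln (x $ idx None) +
     (\<Sum>j \<in> J. \<Sum>a \<in> A j.
        w (Some (j, a)) * (x $ idx (Some (j, a))) * ln (x $ idx (Some (j, a)))) +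
     (\<Sum>j \<in> J. gamma j * (x $ idx (parent j)) * ln (real (card (A j))))"

end

end

theory Submission
  imports Defs
begin

text \<open>
  All weights satisfy \<open>w \<sigma> \<ge> 1\<close> and all coordinates of points of \<open>Q\<close> lie in \<open>[0, 1]\<close>, so the
  Hessian of the entropy, the diagonal matrix with entries \<open>w \<sigma> / x \<sigma>\<close>, dominates the identity.
  For the minimum, regrouping the weights by parent sequences rewrites the entropy as
  \<open>\<Sum>j. \<gamma> j * (\<Sum>a. x\<^sub>j\<^sub>a ln x\<^sub>j\<^sub>a - x\<^sub>p ln x\<^sub>p + x\<^sub>p ln n)\<close>, where \<open>p\<close> is the parent of \<open>j\<close> and
  \<open>n\<close> its number of actions. Each summand is a scaled Kullback-Leibler divergence to the uniform
  distribution, so the minimum \<open>0\<close> is attained at the uniform strategy.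
\<close>

section \<open>The negative entropy\<close>

lemma continuous_on_x_ln_x: "continuous_on {0..} (\<lambda>x::real. x * ln x)"
  unfolding continuous_on_def
proof
  fix x :: real assume "x \<in> {0..}"
  show "((\<lambda>x. x * ln x) \<longlongrightarrow> x * ln x) (at x within {0..})"
  proof (cases "x = 0")
    case True
    \<comment> \<open>Only the endpoint needs a limit argument; there \<open>x * ln x\<close> takes
      the value 0 because of the factor 0.\<close>
    have "((\<lambda>x::real. x * ln x) \<longlongrightarrow> 0) (at_right 0)"
      by real_asymp
    then show ?thesis using True by (simp add: at_within_Ici_at_right)
  next
    case False
    then show ?thesis by (intro tendsto_intros) auto
  qed
qed

text \<open>One-dimensional strong convexity of \<open>x * ln x\<close>: on (0, 1] the slope
  \<open>1 / x\<close> of \<open>ln\<close> is at least 1. The inequality is symmetric in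
  \<open>a\<close> and \<open>b\<close>, so the case \<open>b \<le> a\<close> suffices; there
  \<open>ln t \<le> t - 1\<close> at \<open>t = b / a\<close> gives it.\<close>

lemma ln_diff_mult_ge_square:
  fixes a b :: real
  assumes "0 < a" "a \<le> 1" "0 < b" "b \<le> 1"
  shows "(a - b)\<^sup>2 \<le> (ln a - ln b) * (a - b)"
proof -
  have *: "(a - b)\<^sup>2 \<le> (ln a - ln b) * (a - b)" if "0 < b" "b \<le> a" "a \<le> 1" for a b :: real
  proof -
    have "ln (b / a) \<le> b / a - 1"
      using that by (intro ln_le_minus_one) auto
    then have "ln a - ln b \<ge> (a - b) / a"
      using that by (simp add: ln_div diff_divide_distrib)
    moreover have "(a - b) / a \<ge> a - b"
      using that by (simp add: le_divide_eq mult_left_le)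
    ultimately show ?thesis
      using that by (simp add: power2_eq_square mult_right_mono)
  qed
  show ?thesis
    using *[of b a] *[of a b] assms
    by (cases "b \<le> a") (auto simp: power2_commute[of a b] algebra_simps)
qed

text \<open>Unnormalised Gibbs inequality against the uniform distribution. Each term uses
  \<open>ln t \<le> t - 1\<close> at \<open>t = p / (n * f a)\<close>; the resulting lower bounds
  \<open>f a - p / n\<close> sum to 0.\<close>

lemma sum_x_ln_x_ge:
  fixes f :: "'a \<Rightarrow> real"
  assumes "finite S" "S \<noteq> {}" "\<And>a. a \<in> S \<Longrightarrow> 0 \<le> f a"
  defines "p \<equiv> sum f S"
  shows "p * ln p - p * ln (real (card S)) \<le> (\<Sum>a\<in>S. f a * ln (f a))"
proof (cases "p = 0")
  case True
  then have "\<And>a. a \<in> S \<Longrightarrow> f a = 0"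
    using assms by (simp add: sum_nonneg_eq_0_iff)
  then show ?thesis using True by simp
next
  case False
  then have p: "p > 0"
    using assms by (simp add: order_less_le sum_nonneg)
  define n where "n = real (card S)"
  have n: "n > 0" using assms by (simp add: n_def card_gt_0_iff)
  have "f a - p / n \<le> f a * ln (f a) - f a * ln p + f a * ln n" if "a \<in> S" for a
  proof (cases "f a = 0")
    case True
    then show ?thesis using p n by simp
  next
    case False
    then have fa: "f a > 0" using assms(3)[OF that] by simp
    have "ln (p / (n * f a)) \<le> p / (n * f a) - 1"
      using p n fa by (intro ln_le_minus_one) auto
    then have "1 - p / (n * f a) \<le> ln (f a) - ln p + ln n"
      using p n fa by (simp add: ln_div ln_mult)
    then have "f a * (1 - p / (n * f a)) \<le> f a * (ln (f a) - ln p + ln n)"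
      using fa by (intro mult_left_mono) auto
    then show ?thesis
      using fa n by (simp add: algebra_simps)
  qed
  then have "(\<Sum>a\<in>S. f a - p / n) \<le> (\<Sum>a\<in>S. f a * ln (f a) - f a * ln p + f a * ln n)"
    by (rule sum_mono)
  then show ?thesis
    using n by (simp add: sum.distrib sum_subtractf p_def n_def flip: sum_distrib_right)
qed

section \<open>Gradients relative to the relative interior\<close>

text \<open>Derivatives within a lower-dimensional set are not unique, but their values on
  directions inside the set are: along the segment from \<open>x\<close> to \<open>y\<close> they
  reduce to the unique one-sided derivative of a function of one real variable.\<close>

lemma relint_gradient_eq_on_differences:
  fixes X :: "'v::euclidean_space set"
  assumes "convex X" and x: "x \<in> rel_interior X" and y: "y \<in> rel_interior X"
    and g: "relint_gradient X d x g" and D: "(d has_derivative D) (at x within rel_interior X)"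
  shows "g \<bullet> (y - x) = D (y - x)"
proof -
  define l where "l = (\<lambda>t::real. x + t *\<^sub>R (y - x))"
  have l: "l ` {0..1} \<subseteq> rel_interior X"
  proof safe
    fix t :: real assume "t \<in> {0..1}"
    then have "(1 - t) *\<^sub>R x + t *\<^sub>R y \<in> rel_interior X"
      using convexD_alt[OF convex_rel_interior[OF \<open>convex X\<close>] x y] by auto
    then show "l t \<in> rel_interior X" by (simp add: l_def algebra_simps)
  qed
  have dl: "(l has_derivative (\<lambda>t. t *\<^sub>R (y - x))) (at 0 within {0..1})"
    unfolding l_def by (auto intro!: derivative_eq_intros)
  have along: "((d \<circ> l) has_vector_derivative E (y - x)) (at 0 within {0..1})"
    if E: "(d has_derivative E) (at x within rel_interior X)" for E
  proof -
    have "(d has_derivative E) (at (l 0) within l ` {0..1})"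
      using has_derivative_subset[OF E l] by (simp add: l_def)
    from diff_chain_within[OF dl this] show ?thesis
      using linear_scale[OF has_derivative_linear[OF E]]
      by (simp add: has_vector_derivative_def o_def)
  qed
  show ?thesis
    by (rule vector_derivative_unique_within_closed_interval[OF _ _
          along[OF g[unfolded relint_gradient_def], folded box_real]
          along[OF D, folded box_real]]) auto
qed

section \<open>The sequence-form polytope\<close>

context tfsdp
begin

text \<open>Opposite direction to \<open>wf_child\<close>: the induction hypothesis concerns the
  parent decision point, so arguments run from the roots downwards.\<close>

lemma wf_parent: "wf {(j, j'). j \<in> J \<and> (\<exists>a \<in> A j. j' \<in> C j a)}"
proof (rule finite_acyclic_wf[OF _ C_acyclic])
  have "{(j, j'). j \<in> J \<and> (\<exists>a \<in> A j. j' \<in> C j a)} \<subseteq> J \<times> J" using C_subset by blast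
  then show "finite {(j, j'). j \<in> J \<and> (\<exists>a \<in> A j. j' \<in> C j a)}"
    using finite_J by (blast intro: finite_subset)
qed

lemma parent_SomeD:
  assumes "parent j = Some (j', a)"
  shows "j' \<in> J" "a \<in> A j'" "j \<in> C j' a"
proof -
  from assms obtain j'' a'' where *: "j'' \<in> J" "a'' \<in> A j''" "j \<in> C j'' a''"
    by (auto simp: parent_def split: if_splits)
  with parent_eq_Some[OF this] assms show "j' \<in> J" "a \<in> A j'" "j \<in> C j' a" by auto
qed

lemma parent_in_sequences: "parent j \<in> sequences"
  by (cases "parent j") (auto simp: sequences_def dest: parent_SomeD)

lemma None_in_sequences [simp]: "None \<in> sequences"
  and Some_in_sequences [simp]: "Some (j, a) \<in> sequences \<longleftrightarrow> j \<in> J \<and> a \<in> A j"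
  by (auto simp: sequences_def)

lemma sequences_eq: "sequences = insert None (Some ` Sigma J A)"
  by (auto simp: sequences_def)

lemma finite_sequences: "finite sequences"
  unfolding sequences_eq using finite_J finite_A by (intro finite.insertI finite_imageI finite_SigmaI)

lemma sum_sequences:
  "(\<Sum>\<sigma>\<in>sequences. f \<sigma>) = f None + (\<Sum>j\<in>J. \<Sum>a\<in>A j. f (Some (j, a)))"
proof -
  have "(\<Sum>\<sigma>\<in>sequences. f \<sigma>) = f None + (\<Sum>(j, a)\<in>Sigma J A. f (Some (j, a)))"
    unfolding sequences_eq using finite_J finite_A
    by (subst sum.insert) (auto simp: sum.reindex split_def)
  also have "(\<Sum>(j, a)\<in>Sigma J A. f (Some (j, a))) = (\<Sum>j\<in>J. \<Sum>a\<in>A j. f (Some (j, a)))"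
    using finite_J finite_A by (intro sum.Sigma[symmetric]) auto
  finally show ?thesis .
qed

section \<open>Lower bounds and regrouping of the weights\<close>

lemma gamma_ge_1: "j \<in> J \<Longrightarrow> 1 \<le> gamma j"
proof (induction j rule: wf_induct_rule[OF wf_child])
  case (1 j)
  obtain a where a: "a \<in> A j" using A_nonempty "1.prems" by blast
  have "0 \<le> (\<Sum>j'\<in>C j a. gamma j')"
  proof (rule sum_nonneg)
    fix j' assume "j' \<in> C j a"
    then show "0 \<le> gamma j'"
      using "1.IH"[of j'] "1.prems" a C_subset[of j a] by force
  qed
  also have "\<dots> \<le> Max ((\<lambda>a. \<Sum>j' \<in> C j a. gamma j') ` A j)"
    using a finite_A "1.prems" by (intro Max_ge) auto
  finally show ?case
    using "1.prems" by (subst gamma.simps) simp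
qed

text \<open>The maximum in \<open>gamma j\<close> dominates the child sum of every single action, so
  subtracting that sum leaves at least the summand 1. At \<open>None\<close> exactly 1
  remains.\<close>

lemma w_ge_1:
  assumes "\<sigma> \<in> sequences"
  shows "1 \<le> w \<sigma>"
proof (cases \<sigma>)
  case None
  then show ?thesis by (simp add: gamma_root_def)
next
  case (Some ja)
  then obtain j a where ja: "\<sigma> = Some (j, a)" "j \<in> J" "a \<in> A j"
    using assms by (cases ja) auto
  have "(\<Sum>j'\<in>C j a. gamma j') \<le> Max ((\<lambda>a. \<Sum>j' \<in> C j a. gamma j') ` A j)"
    using ja finite_A by (intro Max_ge) auto
  moreover have "gamma j = 1 + Max ((\<lambda>a. \<Sum>j' \<in> C j a. gamma j') ` A j)"
    using ja by (subst gamma.simps) simp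
  ultimately show ?thesis
    using ja by simp
qed

text \<open>Decision points are grouped by parent sequence: the fibre over \<open>None\<close> is
  \<open>roots\<close>, the one over \<open>Some (j, a)\<close> is \<open>C j a\<close>.\<close>

lemma sum_over_parents:
  fixes f :: "('j \<times> 'a) option \<Rightarrow> real"
  shows "(\<Sum>j\<in>J. gamma j * f (parent j)) =
    (\<Sum>j\<in>roots. gamma j) * f None +
    (\<Sum>j\<in>J. \<Sum>a\<in>A j. (\<Sum>j'\<in>C j a. gamma j') * f (Some (j, a)))"
proof -
  have fibre: "{j' \<in> J. parent j' = Some (j, a)} = C j a" if "j \<in> J" "a \<in> A j" for j a
    using that C_subset parent_eq_Some_iff[OF that] by blast
  have "(\<Sum>j\<in>J. gamma j * f (parent j)) =
      (\<Sum>\<sigma>\<in>sequences. \<Sum>j\<in>{j \<in> J. parent j = \<sigma>}. gamma j * f (parent j))"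
    using finite_J finite_sequences parent_in_sequences by (intro sum.group[symmetric]) auto
  also have "\<dots> = (\<Sum>\<sigma>\<in>sequences. (\<Sum>j\<in>{j \<in> J. parent j = \<sigma>}. gamma j) * f \<sigma>)"
    by (simp add: sum_distrib_right)
  finally show ?thesis
    by (simp add: sum_sequences roots_def fibre)
qed

section \<open>The uniform strategy\<close>

text \<open>Probability of the choices leading to \<open>j\<close> when every action is drawn
  uniformly: the product of the reciprocals of the action counts along the path from the
  root.\<close>

function uniform_reach :: "'j \<Rightarrow> real" where
  "uniform_reach j = (case parent j of None \<Rightarrow> 1
     | Some (j', a) \<Rightarrow> uniform_reach j' / real (card (A j')))"
  by auto
termination
  by (relation "{(j, j'). j \<in> J \<and> (\<exists>a \<in> A j. j' \<in> C j a)}")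
    (use wf_parent in \<open>auto dest: parent_SomeD\<close>)

declare uniform_reach.simps [simp del]

fun uniform_strategy :: "('j \<times> 'a) option \<Rightarrow> real" where
  "uniform_strategy None = 1"
| "uniform_strategy (Some (j, a)) = uniform_reach j / real (card (A j))"

lemma uniform_strategy_parent: "uniform_strategy (parent j) = uniform_reach j"
  by (subst uniform_reach.simps) (auto split: option.split)

lemma card_A_pos: "j \<in> J \<Longrightarrow> 0 < card (A j)"
  using finite_A A_nonempty by (simp add: card_gt_0_iff)

lemma uniform_reach_pos: "0 < uniform_reach j"
proof (induction j rule: wf_induct_rule[OF wf_parent])
  case (1 j)
  then show ?case
    by (subst uniform_reach.simps)
      (auto split: option.split dest: parent_SomeD intro!: divide_pos_pos card_A_pos)
qed

lemma uniform_strategy_pos: "\<sigma> \<in> sequences \<Longrightarrow> 0 < uniform_strategy \<sigma>"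
  by (auto simp: sequences_def uniform_reach_pos card_A_pos)

end

section \<open>Coordinates, compactness and relative interior\<close>

text \<open>Since \<open>idx\<close> is onto, \<open>real ^ 's\<close> has no coordinate left
  unconstrained by the polytope; boundedness of \<open>Q\<close> and the expansion of the norm over
  sequences rest on this.\<close>

locale indexed_tfsdp = tfsdp J A C
  for J :: "'j set" and A :: "'j \<Rightarrow> 'a set" and C :: "'j \<Rightarrow> 'a \<Rightarrow> 'j set" +
  fixes idx :: "('j \<times> 'a) option \<Rightarrow> 's::finite"
  assumes bij_idx: "bij_betw idx sequences UNIV"
begin

abbreviation Q :: "(real ^ 's) set" where
  "Q \<equiv> sequence_polytope idx"

lemma sum_idx: "(\<Sum>s\<in>UNIV. f s) = (\<Sum>\<sigma>\<in>sequences. f (idx \<sigma>))"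
  using sum.reindex_bij_betw[OF bij_idx, of f] by simp

lemma idx_cases: obtains \<sigma> where "\<sigma> \<in> sequences" "s = idx \<sigma>"
  using bij_idx by (auto simp: bij_betw_def)

lemma
  assumes "x \<in> Q"
  shows polytope_nonneg: "\<sigma> \<in> sequences \<Longrightarrow> 0 \<le> x $ idx \<sigma>"
    and polytope_None: "x $ idx None = 1"
    and polytope_sum: "j \<in> J \<Longrightarrow> (\<Sum>a \<in> A j. x $ idx (Some (j, a))) = x $ idx (parent j)"
  using assms by (auto simp: sequence_polytope_def)

lemma polytope_le_parent:
  assumes "x \<in> Q" "j \<in> J" "a \<in> A j"
  shows "x $ idx (Some (j, a)) \<le> x $ idx (parent j)"
proof -
  have "x $ idx (Some (j, a)) \<le> (\<Sum>a \<in> A j. x $ idx (Some (j, a)))"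
    using assms finite_A polytope_nonneg by (intro member_le_sum) auto
  then show ?thesis using polytope_sum assms by simp
qed

text \<open>Mass starts at 1 at the empty sequence and cannot grow along a path, because each
  sequence carries at most the mass of the parent of its decision point.\<close>

lemma polytope_parent_le_1:
  assumes "x \<in> Q"
  shows "x $ idx (parent j) \<le> 1"
proof (induction j rule: wf_induct_rule[OF wf_parent])
  case (1 j)
  show ?case
  proof (cases "parent j")
    case None
    then show ?thesis using polytope_None assms by simp
  next
    case (Some ja)
    then obtain j' a where *: "parent j = Some (j', a)" by (cases ja) auto
    note ** = parent_SomeD[OF *]
    have "x $ idx (Some (j', a)) \<le> x $ idx (parent j')"
      using assms ** by (intro polytope_le_parent)
    also have "\<dots> \<le> 1" using ** by (intro 1) auto
    finally show ?thesis using * by simp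
  qed
qed

lemma polytope_le_1:
  assumes "x \<in> Q" "\<sigma> \<in> sequences"
  shows "x $ idx \<sigma> \<le> 1"
  using assms polytope_None polytope_parent_le_1 polytope_le_parent
  by (force simp: sequences_def intro: order_trans)

lemma convex_polytope: "convex Q"
proof (rule convexI)
  fix x y :: "real ^ 's" and u v :: real
  assume "x \<in> Q" "y \<in> Q" "0 \<le> u" "0 \<le> v" "u + v = 1"
  then show "u *\<^sub>R x + v *\<^sub>R y \<in> Q"
    unfolding sequence_polytope_def
    by (auto simp: sum.distrib simp flip: sum_distrib_left)
qed

lemma compact_polytope: "compact Q"
proof -
  have "closed Q"
    unfolding sequence_polytope_def Ball_def
    by (intro closed_Collect_conj closed_Collect_all closed_Collect_imp
        open_Collect_const closed_Collect_le closed_Collect_eq continuous_intros)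
  moreover have "Q \<subseteq> cbox 0 1"
  proof
    fix x assume "x \<in> Q"
    then have "0 \<le> x $ s \<and> x $ s \<le> 1" for s
      using polytope_nonneg polytope_le_1 by (metis idx_cases)
    then show "x \<in> cbox 0 1" by (simp add: mem_box_cart)
  qed
  ultimately show ?thesis
    using compact_Int_closed[OF compact_cbox] by (metis inf.absorb2)
qed

text \<open>Used twice: as a strictly positive reference point for the relative interior, and as the
  minimiser of the entropy.\<close>

definition uniform_point :: "real ^ 's" where
  "uniform_point = (\<chi> s. uniform_strategy (inv_into sequences idx s))"

lemma uniform_point_nth: "\<sigma> \<in> sequences \<Longrightarrow> uniform_point $ idx \<sigma> = uniform_strategy \<sigma>"
  using bij_idx by (simp add: uniform_point_def bij_betw_def)

lemma uniform_point_in_polytope: "uniform_point \<in> Q"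
proof -
  have "(\<Sum>a \<in> A j. uniform_point $ idx (Some (j, a))) = uniform_point $ idx (parent j)"
    if "j \<in> J" for j
    using that card_A_pos[OF that]
    by (simp add: uniform_point_nth parent_in_sequences uniform_strategy_parent)
  then show ?thesis
    by (auto simp: sequence_polytope_def uniform_point_nth less_imp_le uniform_strategy_pos)
qed

text \<open>From a relative interior point one can move slightly further away from
  \<open>uniform_point\<close> (this is \<open>e > 1\<close>) and stay in \<open>Q\<close>. A zero
  coordinate would turn negative, as that of \<open>uniform_point\<close> is positive.\<close>

lemma rel_interior_polytope_pos:
  assumes x: "x \<in> rel_interior Q" and \<sigma>: "\<sigma> \<in> sequences"
  shows "0 < x $ idx \<sigma>"
proof -
  obtain e where e: "e > 1" "(1 - e) *\<^sub>R uniform_point + e *\<^sub>R x \<in> Q"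
    using x convex_rel_interior_iff[OF convex_polytope, of x] uniform_point_in_polytope by auto
  then have "0 \<le> (1 - e) * uniform_strategy \<sigma> + e * x $ idx \<sigma>"
    using polytope_nonneg[OF e(2) \<sigma>] uniform_point_nth[OF \<sigma>] by simp
  moreover have "(1 - e) * uniform_strategy \<sigma> < 0"
    using e uniform_strategy_pos[OF \<sigma>] by (intro mult_neg_pos) auto
  ultimately have "0 < e * x $ idx \<sigma>" by linarith
  then show ?thesis using e(1) by (simp add: zero_less_mult_iff)
qed

section \<open>The dilatable global entropy\<close>

lemma dilatable_entropy_sequences:
  "dilatable_entropy idx x =
    (\<Sum>\<sigma>\<in>sequences. w \<sigma> * (x $ idx \<sigma> * ln (x $ idx \<sigma>))) +
    (\<Sum>j \<in> J. gamma j * x $ idx (parent j) * ln (real (card (A j))))"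
  by (simp add: dilatable_entropy_def sum_sequences mult.assoc)

lemma dilatable_entropy_eq_dilated:
  assumes "x \<in> Q"
  shows "dilatable_entropy idx x =
    (\<Sum>j\<in>J. gamma j * ((\<Sum>a\<in>A j. x $ idx (Some (j, a)) * ln (x $ idx (Some (j, a)))) -
      x $ idx (parent j) * ln (x $ idx (parent j)) +
      x $ idx (parent j) * ln (real (card (A j)))))"
proof -
  define f where "f \<sigma> = x $ idx \<sigma> * ln (x $ idx \<sigma>)" for \<sigma>
  \<comment> \<open>The root term vanishes because \<open>1 * ln 1 = 0\<close>, so both
    \<open>w None\<close> and the sum over \<open>roots\<close> drop out of the regrouping.\<close>
  have f0: "f None = 0" using polytope_None[OF assms] by (simp add: f_def)
  have "(\<Sum>\<sigma>\<in>sequences. w \<sigma> * f \<sigma>) =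
      (\<Sum>j\<in>J. \<Sum>a\<in>A j. gamma j * f (Some (j, a))) -
      (\<Sum>j\<in>J. \<Sum>a\<in>A j. (\<Sum>j'\<in>C j a. gamma j') * f (Some (j, a)))"
    by (simp add: sum_sequences f0 left_diff_distrib sum_subtractf)
  also have "(\<Sum>j\<in>J. \<Sum>a\<in>A j. (\<Sum>j'\<in>C j a. gamma j') * f (Some (j, a))) =
      (\<Sum>j\<in>J. gamma j * f (parent j))"
    by (simp add: sum_over_parents f0)
  finally show ?thesis
    unfolding dilatable_entropy_sequences f_def[symmetric]
    by (simp add: sum_distrib_left distrib_left right_diff_distrib sum.distrib sum_subtractf
        mult.assoc)
qed

section \<open>The minimum value\<close>

lemma dilatable_entropy_nonneg:
  assumes "x \<in> Q"
  shows "0 \<le> dilatable_entropy idx x"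
  unfolding dilatable_entropy_eq_dilated[OF assms]
proof (intro sum_nonneg mult_nonneg_nonneg)
  fix j assume j: "j \<in> J"
  then show "0 \<le> gamma j" using gamma_ge_1[OF j] by simp
  show "0 \<le> (\<Sum>a\<in>A j. x $ idx (Some (j, a)) * ln (x $ idx (Some (j, a)))) -
      x $ idx (parent j) * ln (x $ idx (parent j)) + x $ idx (parent j) * ln (real (card (A j)))"
    \<comment> \<open>The flow constraint identifies the total mass \<open>p\<close> of the Gibbs
      inequality with the parent coordinate.\<close>
    using sum_x_ln_x_ge[OF finite_A[OF j] A_nonempty[OF j], of "\<lambda>a. x $ idx (Some (j, a))"]
      polytope_nonneg[OF assms] polytope_sum[OF assms j] j by simp
qed

lemma dilatable_entropy_uniform_point: "dilatable_entropy idx uniform_point = 0"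
  unfolding dilatable_entropy_eq_dilated[OF uniform_point_in_polytope]
proof (intro sum.neutral ballI)
  fix j assume j: "j \<in> J"
  then show "gamma j * ((\<Sum>a\<in>A j. uniform_point $ idx (Some (j, a)) *
        ln (uniform_point $ idx (Some (j, a)))) -
      uniform_point $ idx (parent j) * ln (uniform_point $ idx (parent j)) +
      uniform_point $ idx (parent j) * ln (real (card (A j)))) = 0"
    using card_A_pos[OF j] uniform_reach_pos[of j]
    by (simp add: uniform_point_nth parent_in_sequences uniform_strategy_parent ln_div
        right_diff_distrib)
qed

section \<open>Continuity, derivative and strong convexity\<close>

lemma continuous_on_dilatable_entropy: "continuous_on Q (dilatable_entropy idx)"
proof -
  have *: "continuous_on Q (\<lambda>x. x $ idx \<sigma> * ln (x $ idx \<sigma>))" if "\<sigma> \<in> sequences" for \<sigma>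
    using that polytope_nonneg
    by (intro continuous_on_compose2[OF continuous_on_x_ln_x, of Q "\<lambda>x. x $ idx \<sigma>"]
        continuous_intros) auto
  show ?thesis
    unfolding dilatable_entropy_sequences[abs_def]
    by (intro continuous_on_add continuous_on_sum continuous_on_mult_left * continuous_intros)
qed

text \<open>The differential on the whole ambient space, including directions that leave the affine
  hull of \<open>Q\<close>.\<close>

definition entropy_deriv :: "real ^ 's \<Rightarrow> real ^ 's \<Rightarrow> real" where
  "entropy_deriv x h = (\<Sum>\<sigma>\<in>sequences. w \<sigma> * ((ln (x $ idx \<sigma>) + 1) * h $ idx \<sigma>)) +
    (\<Sum>j \<in> J. gamma j * h $ idx (parent j) * ln (real (card (A j))))"

lemma has_derivative_dilatable_entropy:
  assumes "\<And>\<sigma>. \<sigma> \<in> sequences \<Longrightarrow> 0 < x $ idx \<sigma>"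
  shows "(dilatable_entropy idx has_derivative entropy_deriv x) (at x within S)"
proof -
  have nth: "((\<lambda>x. x $ i) has_derivative (\<lambda>h. h $ i)) (at x within S)" for i
    by (rule bounded_linear_imp_has_derivative[OF bounded_linear_vec_nth])
  have "((\<lambda>x. x $ idx \<sigma> * ln (x $ idx \<sigma>)) has_derivative
      (\<lambda>h. (ln (x $ idx \<sigma>) + 1) * h $ idx \<sigma>)) (at x within S)" if "\<sigma> \<in> sequences" for \<sigma>
    using assms[OF that]
    by (auto intro!: derivative_eq_intros nth simp: field_simps)
  then show ?thesis
    unfolding dilatable_entropy_sequences[abs_def] entropy_deriv_def[abs_def]
    by (intro has_derivative_add has_derivative_sum has_derivative_mult_right
        has_derivative_mult_left nth) auto
qed

text \<open>The terms with \<open>gamma\<close> and the constant 1 do not depend on the base point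
  and cancel. What remains is bounded coordinate by coordinate through
  \<open>ln_diff_mult_ge_square\<close>.\<close>

lemma entropy_deriv_strongly_monotone:
  assumes "x \<in> rel_interior Q" "y \<in> rel_interior Q"
  shows "(norm (x - y))\<^sup>2 \<le> entropy_deriv x (x - y) - entropy_deriv y (x - y)"
proof -
  have xy: "x \<in> Q" "y \<in> Q" using assms rel_interior_subset by blast+
  have "(norm (x - y))\<^sup>2 = (\<Sum>\<sigma>\<in>sequences. (x $ idx \<sigma> - y $ idx \<sigma>)\<^sup>2)"
    unfolding power2_norm_eq_inner by (simp add: inner_vec_def sum_idx power2_eq_square)
  also have "\<dots> \<le> (\<Sum>\<sigma>\<in>sequences.
      w \<sigma> * ((ln (x $ idx \<sigma>) - ln (y $ idx \<sigma>)) * (x $ idx \<sigma> - y $ idx \<sigma>)))"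
  proof (rule sum_mono)
    fix \<sigma> assume \<sigma>: "\<sigma> \<in> sequences"
    have *: "(x $ idx \<sigma> - y $ idx \<sigma>)\<^sup>2
        \<le> (ln (x $ idx \<sigma>) - ln (y $ idx \<sigma>)) * (x $ idx \<sigma> - y $ idx \<sigma>)"
      using assms xy \<sigma> by (intro ln_diff_mult_ge_square rel_interior_polytope_pos polytope_le_1)
    \<comment> \<open>Enlarging the factor from 1 to \<open>w \<sigma>\<close> is monotone because
      the product is nonnegative, being bounded below by a square.\<close>
    also have "1 * \<dots> \<le> w \<sigma> * \<dots>"
      using w_ge_1[OF \<sigma>] order_trans[OF zero_le_power2 *] by (rule mult_right_mono)
    finally show "(x $ idx \<sigma> - y $ idx \<sigma>)\<^sup>2
        \<le> w \<sigma> * ((ln (x $ idx \<sigma>) - ln (y $ idx \<sigma>)) * (x $ idx \<sigma> - y $ idx \<sigma>))" by simp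
  qed
  also have "\<dots> = entropy_deriv x (x - y) - entropy_deriv y (x - y)"
    by (simp add: entropy_deriv_def flip: sum_subtractf) (simp add: algebra_simps)
  finally show ?thesis .
qed

lemma strongly_convex_dilatable_entropy:
  "strongly_convex_on_relint 1 norm Q (dilatable_entropy idx)"
  unfolding strongly_convex_on_relint_def
proof (intro conjI ballI allI impI)
  have D: "(dilatable_entropy idx has_derivative entropy_deriv x) (at x within rel_interior Q)"
    if "x \<in> rel_interior Q" for x
    using that by (intro has_derivative_dilatable_entropy rel_interior_polytope_pos)
  then show "dilatable_entropy idx differentiable_on rel_interior Q"
    by (auto simp: differentiable_on_def differentiable_def)
  fix x y g g'
  assume x: "x \<in> rel_interior Q" and y: "y \<in> rel_interior Q"
    and g: "relint_gradient Q (dilatable_entropy idx) x g"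
    and g': "relint_gradient Q (dilatable_entropy idx) y g'"
  \<comment> \<open>Gradients are only controlled in directions from their base point into the
    relative interior, hence \<open>y - x\<close> here; linearity of \<open>entropy_deriv x\<close>
    then reverses the sign.\<close>
  have "g \<bullet> (y - x) = entropy_deriv x (y - x)"
    by (rule relint_gradient_eq_on_differences[OF convex_polytope x y g D[OF x]])
  moreover have "entropy_deriv x (y - x) = - entropy_deriv x (x - y)"
    using linear_neg[OF has_derivative_linear[OF D[OF x]], of "x - y"] by simp
  moreover have "g' \<bullet> (x - y) = entropy_deriv y (x - y)"
    by (rule relint_gradient_eq_on_differences[OF convex_polytope y x g' D[OF y]])
  ultimately show "1 * (norm (x - y))\<^sup>2 \<le> (g - g') \<bullet> (x - y)"
    using entropy_deriv_strongly_monotone[OF x y]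
    by (simp add: inner_diff_left inner_diff_right)
qed

lemma is_dgf_dilatable_entropy: "is_dgf Q (dilatable_entropy idx)"
proof -
  have "is_norm (norm :: real ^ 's \<Rightarrow> real)"
    by (simp add: is_norm_def norm_triangle_ineq)
  moreover have "dilatable_entropy idx differentiable_on rel_interior Q"
    using strongly_convex_dilatable_entropy by (simp add: strongly_convex_on_relint_def)
  ultimately show ?thesis
    unfolding is_dgf_def
    using compact_polytope convex_polytope continuous_on_dilatable_entropy
      strongly_convex_dilatable_entropy uniform_point_in_polytope dilatable_entropy_uniform_point
      dilatable_entropy_nonneg zero_less_one
    by blast
qed

end

theorem theorem4:
  fixes J :: "'j set" and A :: "'j \<Rightarrow> 'a set" and C :: "'j \<Rightarrow> 'a \<Rightarrow> 'j set"
    and idx :: "('j \<times> 'a) option \<Rightarrow> 's::finite"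
  assumes "tfsdp J A C"
    and "bij_betw idx (tfsdp.sequences J A) (UNIV :: 's set)"
  shows "is_dgf (tfsdp.sequence_polytope J A C idx) (tfsdp.dilatable_entropy J A C idx) \<and>
    strongly_convex_on_relint 1 norm
      (tfsdp.sequence_polytope J A C idx) (tfsdp.dilatable_entropy J A C idx)"
proof -
  interpret tfsdp J A C by fact
  interpret indexed_tfsdp J A C idx by unfold_locales fact
  show ?thesis
    using is_dgf_dilatable_entropy strongly_convex_dilatable_entropy by blast
qed

end
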